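(* Let $M\mapsto M^*$ be the translation from the untyped monadic reflection calculus to the untyped delimited control calculus that is homomorphic on all core constructs and satisfies $(\mathtt{reflect}\,M)^*=\mathcal{S}_0k.\lambda b.\,b!\,(\{M^*\},\{\lambda x.\,k!\,x\,b\})$ and $(\mathtt{reify}_{T}\,M)^*=\langle M^*\mid x.\lambda b.N_u^*\rangle\,\{\lambda(y,f).N_b^*\}$ for $T=\mathtt{where}\{\mathtt{return}\,x=N_u;\ y\gg\!=f=N_b\}$ (with $b,k$ fresh, and $\lambda(y,f).P$ abbreviating $\lambda w.\,\mathtt{let}\,(y,f)=w\,\mathtt{in}\,P$ for fresh $w$). Then for all computations $M,N$ of the monadic reflection calculus, $M\to N$ implies $M^*\rightsquigarrow^{+}N^*$.
   Context: Core syntax (shared). Values $V ::= x \mid () \mid (V_1,V_2) \mid \ell\,V \mid \{M\}$; computations $M,N ::= \mathtt{let}\,(x,y)=V\,\mathtt{in}\,M \mid \mathtt{case}\,V\,\mathtt{of}\,\{\ell_i x_i\mapsto M_i\}_i \mid V! \mid \mathtt{return}\,V \mid \mathtt{let}\,x\Leftarrow M\,\mathtt{in}\,N \mid \lambda x.M \mid M\,V \mid \langle M_1,M_2\rangle \mid \mathrm{prj}_i M$. Core $\beta$-rules: $\mathtt{let}\,(x,y)=(V_1,V_2)\,\mathtt{in}\,M \to_\beta M[V_1/x,V_2/y]$; $\mathtt{case}\,\ell_j V\,\mathtt{of}\,\{\dots\ell_j x_j\mapsto M_j\dots\}\to_\beta M_j[V/x_j]$; $\{M\}!\to_\beta M$;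 $\mathtt{let}\,x\Leftarrow\mathtt{return}\,V\,\mathtt{in}\,N\to_\beta N[V/x]$; $(\lambda x.M)V\to_\beta M[V/x]$; $\mathrm{prj}_i\langle M_1,M_2\rangle\to_\beta M_i$. Basic frames $B ::= \mathtt{let}\,x\Leftarrow[\,]\,\mathtt{in}\,N\mid[\,]\,V\mid\mathrm{prj}_i[\,]$; hoisting contexts $\mathcal{H}::=[\,]\mid\mathcal{H}[B]$. In each calculus $M\to N$ iff $M=K[M']$, $N=K[N']$ with $M'\to_\beta N'$ and $K$ an evaluation context of that calculus. Monadic reflection calculus: monad terms $T=\mathtt{where}\{\mathtt{return}\,x=N_u;\ y\gg\!=f=N_b\}$; adds computations $\mathtt{reflect}\,N$ and $\mathtt{reify}_T\,M$; evaluation contexts $K::=[\,]\mid K[B]\mid K[\mathtt{reify}_T[\,]]$; extra rules $\mathtt{reify}_T(\mathtt{return}\,V)\to_\beta N_u[V/x]$ and $\mathtt{reify}_T\,\mathcal{H}[\mathtt{reflect}\,N]\to_\beta N_b[\{N\}/y,\{\lambda z.\mathtt{reify}_T\,\mathcal{H}[\mathtt{return}\,z]\}/f]$. Delimited control calculus: adds computations $\mathcal{S}_0k.M$ and $\langle M\mid x.N\rangle$; evaluation contexts $K::=[\,]\mid K[B]\mid K[\langle[\,]\mid x.N\rangle]$; extra rules $\langle\mathtt{return}\,V\mid x.N\rangle\to_\beta N[V/x]$ and $\langle\mathcal{H}[\mathcal{S}_0k.M]\mid x.N\rangle\to_\beta M[\{\lambda y.\langle\mathcal{H}[\mathtt{return}\,y]\mid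 x.N\rangle\}/k]$. $\rightsquigarrow$ is the smallest relation on terms of the target calculus containing $\to_\beta$ and closed under all term-forming constructs; $\rightsquigarrow^{+}$ is its transitive closure. *)

theory Defs
  imports "HOL-Library.Finite_Map"
begin

text \<open>
  Terms are represented up to alpha-equivalence by de Bruijn indices: a variable counts the
  binders between its occurrence and its binding site.  Where two variables are bound at once
  (let (x, y) = V in M, and y >>= f = N in a monad term), the second one has index 0 and the
  first one index 1.  Labels are drawn from an arbitrary type 'l; the branches of a case form a
  finite map from labels to computations, each binding one variable (index 0).
\<close>

datatype side = One | Two

definition lift_ren :: "(nat \<Rightarrow> nat) \<Rightarrow> nat \<Rightarrow> nat" where
  "lift_ren r = case_nat 0 (\<lambda>n. Suc (r n))"

section \<open>The monadic reflection calculus\<close>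

text \<open>
  \<open>MReify Nu Nb M\<close> stands for reify\<open>\<^sub>T\<close> M with
  T = where {return x = Nu; y >>= f = Nb}: Nu binds x, and Nb binds y (index 1) and f (index 0).
  \<open>MWith\<close> is the computation pair \<open>\<langle>M, N\<rangle>\<close>.
\<close>

datatype 'l mval =
    MVar nat
  | MUnit
  | MPair "'l mval" "'l mval"
  | MInj 'l "'l mval"
  | MThunk "'l mcomp"
and 'l mcomp =
    MSplit "'l mval" "'l mcomp"
  | MCase "'l mval" "('l, 'l mcomp) fmap"
  | MForce "'l mval"
  | MReturn "'l mval"
  | MLet "'l mcomp" "'l mcomp"
  | MLam "'l mcomp"
  | MApp "'l mcomp" "'l mval"
  | MWith "'l mcomp" "'l mcomp"
  | MPrj side "'l mcomp"
  | MReflect "'l mcomp"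
  | MReify "'l mcomp" "'l mcomp" "'l mcomp"

primrec mren_val :: "(nat \<Rightarrow> nat) \<Rightarrow> 'l mval \<Rightarrow> 'l mval"
  and mren_comp :: "(nat \<Rightarrow> nat) \<Rightarrow> 'l mcomp \<Rightarrow> 'l mcomp" where
  "mren_val r (MVar n) = MVar (r n)" |
  "mren_val r MUnit = MUnit" |
  "mren_val r (MPair V W) = MPair (mren_val r V) (mren_val r W)" |
  "mren_val r (MInj l V) = MInj l (mren_val r V)" |
  "mren_val r (MThunk M) = MThunk (mren_comp r M)" |
  "mren_comp r (MSplit V M) = MSplit (mren_val r V) (mren_comp (lift_ren (lift_ren r)) M)" |
  "mren_comp r (MCase V bs) = MCase (mren_val r V) (fmmap (mren_comp (lift_ren r)) bs)" |
  "mren_comp r (MForce V) = MForce (mren_val r V)" |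
  "mren_comp r (MReturn V) = MReturn (mren_val r V)" |
  "mren_comp r (MLet M N) = MLet (mren_comp r M) (mren_comp (lift_ren r) N)" |
  "mren_comp r (MLam M) = MLam (mren_comp (lift_ren r) M)" |
  "mren_comp r (MApp M V) = MApp (mren_comp r M) (mren_val r V)" |
  "mren_comp r (MWith M N) = MWith (mren_comp r M) (mren_comp r N)" |
  "mren_comp r (MPrj i M) = MPrj i (mren_comp r M)" |
  "mren_comp r (MReflect M) = MReflect (mren_comp r M)" |
  "mren_comp r (MReify Nu Nb M) =
     MReify (mren_comp (lift_ren r) Nu) (mren_comp (lift_ren (lift_ren r)) Nb) (mren_comp r M)"

definition mlift :: "(nat \<Rightarrow> 'l mval) \<Rightarrow> nat \<Rightarrow> 'l mval" where
  "mlift s = case_nat (MVar 0) (\<lambda>n. mren_val Suc (s n))"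

primrec msub_val :: "(nat \<Rightarrow> 'l mval) \<Rightarrow> 'l mval \<Rightarrow> 'l mval"
  and msub_comp :: "(nat \<Rightarrow> 'l mval) \<Rightarrow> 'l mcomp \<Rightarrow> 'l mcomp" where
  "msub_val s (MVar n) = s n" |
  "msub_val s MUnit = MUnit" |
  "msub_val s (MPair V W) = MPair (msub_val s V) (msub_val s W)" |
  "msub_val s (MInj l V) = MInj l (msub_val s V)" |
  "msub_val s (MThunk M) = MThunk (msub_comp s M)" |
  "msub_comp s (MSplit V M) = MSplit (msub_val s V) (msub_comp (mlift (mlift s)) M)" |
  "msub_comp s (MCase V bs) = MCase (msub_val s V) (fmmap (msub_comp (mlift s)) bs)" |
  "msub_comp s (MForce V) = MForce (msub_val s V)" |
  "msub_comp s (MReturn V) = MReturn (msub_val s V)" |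
  "msub_comp s (MLet M N) = MLet (msub_comp s M) (msub_comp (mlift s) N)" |
  "msub_comp s (MLam M) = MLam (msub_comp (mlift s) M)" |
  "msub_comp s (MApp M V) = MApp (msub_comp s M) (msub_val s V)" |
  "msub_comp s (MWith M N) = MWith (msub_comp s M) (msub_comp s N)" |
  "msub_comp s (MPrj i M) = MPrj i (msub_comp s M)" |
  "msub_comp s (MReflect M) = MReflect (msub_comp s M)" |
  "msub_comp s (MReify Nu Nb M) =
     MReify (msub_comp (mlift s) Nu) (msub_comp (mlift (mlift s)) Nb) (msub_comp s M)"

definition minst :: "'l mcomp \<Rightarrow> 'l mval \<Rightarrow> 'l mcomp" where
  "minst M V = msub_comp (case_nat V MVar) M"

text \<open>M[V/x, W/y], simultaneously, where M binds x (index 1) and y (index 0).\<close>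

definition minst2 :: "'l mcomp \<Rightarrow> 'l mval \<Rightarrow> 'l mval \<Rightarrow> 'l mcomp" where
  "minst2 M V W = msub_comp (case_nat W (case_nat V MVar)) M"

datatype 'l mframe =
    MFLet "'l mcomp"
  | MFApp "'l mval"
  | MFPrj side

primrec mplug_frame :: "'l mframe \<Rightarrow> 'l mcomp \<Rightarrow> 'l mcomp" where
  "mplug_frame (MFLet N) M = MLet M N" |
  "mplug_frame (MFApp V) M = MApp M V" |
  "mplug_frame (MFPrj i) M = MPrj i M"

primrec mren_frame :: "(nat \<Rightarrow> nat) \<Rightarrow> 'l mframe \<Rightarrow> 'l mframe" where
  "mren_frame r (MFLet N) = MFLet (mren_comp (lift_ren r) N)" |
  "mren_frame r (MFApp V) = MFApp (mren_val r V)" |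
  "mren_frame r (MFPrj i) = MFPrj i"

datatype 'l mhoist =
    MHHole
  | MHFrame "'l mhoist" "'l mframe"

primrec mplug_hoist :: "'l mhoist \<Rightarrow> 'l mcomp \<Rightarrow> 'l mcomp" where
  "mplug_hoist MHHole M = M" |
  "mplug_hoist (MHFrame H B) M = mplug_hoist H (mplug_frame B M)"

primrec mren_hoist :: "(nat \<Rightarrow> nat) \<Rightarrow> 'l mhoist \<Rightarrow> 'l mhoist" where
  "mren_hoist r MHHole = MHHole" |
  "mren_hoist r (MHFrame H B) = MHFrame (mren_hoist r H) (mren_frame r B)"

text \<open>
  No frame binds variables in its hole, so plugging is plain substitution of the hole.  In the
  reify-reflect rule, however, the handler and the hoisting context move under the binder z and
  are weakened accordingly.
\<close>

inductive mbeta :: "'l mcomp \<Rightarrow> 'l mcomp \<Rightarrow> bool" where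
  mbeta_split: "mbeta (MSplit (MPair V W) M) (minst2 M V W)" |
  mbeta_case: "fmlookup bs l = Some M \<Longrightarrow> mbeta (MCase (MInj l V) bs) (minst M V)" |
  mbeta_force: "mbeta (MForce (MThunk M)) M" |
  mbeta_let: "mbeta (MLet (MReturn V) N) (minst N V)" |
  mbeta_app: "mbeta (MApp (MLam M) V) (minst M V)" |
  mbeta_prj1: "mbeta (MPrj One (MWith M N)) M" |
  mbeta_prj2: "mbeta (MPrj Two (MWith M N)) N" |
  mbeta_reify_return: "mbeta (MReify Nu Nb (MReturn V)) (minst Nu V)" |
  mbeta_reify_reflect:
    "mbeta (MReify Nu Nb (mplug_hoist H (MReflect N)))
       (minst2 Nb (MThunk N)
         (MThunk (MLam
           (MReify (mren_comp (lift_ren Suc) Nu) (mren_comp (lift_ren (lift_ren Suc)) Nb)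
             (mplug_hoist (mren_hoist Suc H) (MReturn (MVar 0)))))))"

datatype 'l mectx =
    MEHole
  | MEFrame "'l mectx" "'l mframe"
  | MEReify "'l mectx" "'l mcomp" "'l mcomp"

primrec mplug_ectx :: "'l mectx \<Rightarrow> 'l mcomp \<Rightarrow> 'l mcomp" where
  "mplug_ectx MEHole M = M" |
  "mplug_ectx (MEFrame K B) M = mplug_ectx K (mplug_frame B M)" |
  "mplug_ectx (MEReify K Nu Nb) M = mplug_ectx K (MReify Nu Nb M)"

inductive mstep :: "'l mcomp \<Rightarrow> 'l mcomp \<Rightarrow> bool" where
  "mbeta M N \<Longrightarrow> mstep (mplug_ectx K M) (mplug_ectx K N)"

section \<open>The delimited control calculus\<close>

text \<open>
  \<open>DShift0 M\<close> is the operator S0 k. M, binding k in M; \<open>DReset M N\<close> is the reset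
  \<open>\<langle>M | x. N\<rangle>\<close>, binding x in N.
\<close>

datatype 'l dval =
    DVar nat
  | DUnit
  | DPair "'l dval" "'l dval"
  | DInj 'l "'l dval"
  | DThunk "'l dcomp"
and 'l dcomp =
    DSplit "'l dval" "'l dcomp"
  | DCase "'l dval" "('l, 'l dcomp) fmap"
  | DForce "'l dval"
  | DReturn "'l dval"
  | DLet "'l dcomp" "'l dcomp"
  | DLam "'l dcomp"
  | DApp "'l dcomp" "'l dval"
  | DWith "'l dcomp" "'l dcomp"
  | DPrj side "'l dcomp"
  | DShift0 "'l dcomp"
  | DReset "'l dcomp" "'l dcomp"

primrec dren_val :: "(nat \<Rightarrow> nat) \<Rightarrow> 'l dval \<Rightarrow> 'l dval"
  and dren_comp :: "(nat \<Rightarrow> nat) \<Rightarrow> 'l dcomp \<Rightarrow> 'l dcomp" where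
  "dren_val r (DVar n) = DVar (r n)" |
  "dren_val r DUnit = DUnit" |
  "dren_val r (DPair V W) = DPair (dren_val r V) (dren_val r W)" |
  "dren_val r (DInj l V) = DInj l (dren_val r V)" |
  "dren_val r (DThunk M) = DThunk (dren_comp r M)" |
  "dren_comp r (DSplit V M) = DSplit (dren_val r V) (dren_comp (lift_ren (lift_ren r)) M)" |
  "dren_comp r (DCase V bs) = DCase (dren_val r V) (fmmap (dren_comp (lift_ren r)) bs)" |
  "dren_comp r (DForce V) = DForce (dren_val r V)" |
  "dren_comp r (DReturn V) = DReturn (dren_val r V)" |
  "dren_comp r (DLet M N) = DLet (dren_comp r M) (dren_comp (lift_ren r) N)" |
  "dren_comp r (DLam M) = DLam (dren_comp (lift_ren r) M)" |
  "dren_comp r (DApp M V) = DApp (dren_comp r M) (dren_val r V)" |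
  "dren_comp r (DWith M N) = DWith (dren_comp r M) (dren_comp r N)" |
  "dren_comp r (DPrj i M) = DPrj i (dren_comp r M)" |
  "dren_comp r (DShift0 M) = DShift0 (dren_comp (lift_ren r) M)" |
  "dren_comp r (DReset M N) = DReset (dren_comp r M) (dren_comp (lift_ren r) N)"

definition dlift :: "(nat \<Rightarrow> 'l dval) \<Rightarrow> nat \<Rightarrow> 'l dval" where
  "dlift s = case_nat (DVar 0) (\<lambda>n. dren_val Suc (s n))"

primrec dsub_val :: "(nat \<Rightarrow> 'l dval) \<Rightarrow> 'l dval \<Rightarrow> 'l dval"
  and dsub_comp :: "(nat \<Rightarrow> 'l dval) \<Rightarrow> 'l dcomp \<Rightarrow> 'l dcomp" where
  "dsub_val s (DVar n) = s n" |
  "dsub_val s DUnit = DUnit" |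
  "dsub_val s (DPair V W) = DPair (dsub_val s V) (dsub_val s W)" |
  "dsub_val s (DInj l V) = DInj l (dsub_val s V)" |
  "dsub_val s (DThunk M) = DThunk (dsub_comp s M)" |
  "dsub_comp s (DSplit V M) = DSplit (dsub_val s V) (dsub_comp (dlift (dlift s)) M)" |
  "dsub_comp s (DCase V bs) = DCase (dsub_val s V) (fmmap (dsub_comp (dlift s)) bs)" |
  "dsub_comp s (DForce V) = DForce (dsub_val s V)" |
  "dsub_comp s (DReturn V) = DReturn (dsub_val s V)" |
  "dsub_comp s (DLet M N) = DLet (dsub_comp s M) (dsub_comp (dlift s) N)" |
  "dsub_comp s (DLam M) = DLam (dsub_comp (dlift s) M)" |
  "dsub_comp s (DApp M V) = DApp (dsub_comp s M) (dsub_val s V)" |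
  "dsub_comp s (DWith M N) = DWith (dsub_comp s M) (dsub_comp s N)" |
  "dsub_comp s (DPrj i M) = DPrj i (dsub_comp s M)" |
  "dsub_comp s (DShift0 M) = DShift0 (dsub_comp (dlift s) M)" |
  "dsub_comp s (DReset M N) = DReset (dsub_comp s M) (dsub_comp (dlift s) N)"

definition dinst :: "'l dcomp \<Rightarrow> 'l dval \<Rightarrow> 'l dcomp" where
  "dinst M V = dsub_comp (case_nat V DVar) M"

definition dinst2 :: "'l dcomp \<Rightarrow> 'l dval \<Rightarrow> 'l dval \<Rightarrow> 'l dcomp" where
  "dinst2 M V W = dsub_comp (case_nat W (case_nat V DVar)) M"

datatype 'l dframe =
    DFLet "'l dcomp"
  | DFApp "'l dval"
  | DFPrj side

primrec dplug_frame :: "'l dframe \<Rightarrow> 'l dcomp \<Rightarrow> 'l dcomp" where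
  "dplug_frame (DFLet N) M = DLet M N" |
  "dplug_frame (DFApp V) M = DApp M V" |
  "dplug_frame (DFPrj i) M = DPrj i M"

primrec dren_frame :: "(nat \<Rightarrow> nat) \<Rightarrow> 'l dframe \<Rightarrow> 'l dframe" where
  "dren_frame r (DFLet N) = DFLet (dren_comp (lift_ren r) N)" |
  "dren_frame r (DFApp V) = DFApp (dren_val r V)" |
  "dren_frame r (DFPrj i) = DFPrj i"

datatype 'l dhoist =
    DHHole
  | DHFrame "'l dhoist" "'l dframe"

primrec dplug_hoist :: "'l dhoist \<Rightarrow> 'l dcomp \<Rightarrow> 'l dcomp" where
  "dplug_hoist DHHole M = M" |
  "dplug_hoist (DHFrame H B) M = dplug_hoist H (dplug_frame B M)"

primrec dren_hoist :: "(nat \<Rightarrow> nat) \<Rightarrow> 'l dhoist \<Rightarrow> 'l dhoist" where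
  "dren_hoist r DHHole = DHHole" |
  "dren_hoist r (DHFrame H B) = DHFrame (dren_hoist r H) (dren_frame r B)"

inductive dbeta :: "'l dcomp \<Rightarrow> 'l dcomp \<Rightarrow> bool" where
  dbeta_split: "dbeta (DSplit (DPair V W) M) (dinst2 M V W)" |
  dbeta_case: "fmlookup bs l = Some M \<Longrightarrow> dbeta (DCase (DInj l V) bs) (dinst M V)" |
  dbeta_force: "dbeta (DForce (DThunk M)) M" |
  dbeta_let: "dbeta (DLet (DReturn V) N) (dinst N V)" |
  dbeta_app: "dbeta (DApp (DLam M) V) (dinst M V)" |
  dbeta_prj1: "dbeta (DPrj One (DWith M N)) M" |
  dbeta_prj2: "dbeta (DPrj Two (DWith M N)) N" |
  dbeta_reset_return: "dbeta (DReset (DReturn V) N) (dinst N V)" |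
  dbeta_reset_shift0:
    "dbeta (DReset (dplug_hoist H (DShift0 M)) N)
       (dinst M (DThunk (DLam
         (DReset (dplug_hoist (dren_hoist Suc H) (DReturn (DVar 0)))
           (dren_comp (lift_ren Suc) N)))))"

text \<open>The compatible closure of \<open>dbeta\<close>, under binders and thunks included.\<close>

inductive dred_val :: "'l dval \<Rightarrow> 'l dval \<Rightarrow> bool"
  and dred :: "'l dcomp \<Rightarrow> 'l dcomp \<Rightarrow> bool" where
  dred_pair1: "dred_val V V' \<Longrightarrow> dred_val (DPair V W) (DPair V' W)" |
  dred_pair2: "dred_val W W' \<Longrightarrow> dred_val (DPair V W) (DPair V W')" |
  dred_inj: "dred_val V V' \<Longrightarrow> dred_val (DInj l V) (DInj l V')" |
  dred_thunk: "dred M M' \<Longrightarrow> dred_val (DThunk M) (DThunk M')" |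
  dred_beta: "dbeta M M' \<Longrightarrow> dred M M'" |
  dred_split1: "dred_val V V' \<Longrightarrow> dred (DSplit V M) (DSplit V' M)" |
  dred_split2: "dred M M' \<Longrightarrow> dred (DSplit V M) (DSplit V M')" |
  dred_case1: "dred_val V V' \<Longrightarrow> dred (DCase V bs) (DCase V' bs)" |
  dred_case2: "fmlookup bs l = Some M \<Longrightarrow> dred M M' \<Longrightarrow>
     dred (DCase V bs) (DCase V (fmupd l M' bs))" |
  dred_force: "dred_val V V' \<Longrightarrow> dred (DForce V) (DForce V')" |
  dred_return: "dred_val V V' \<Longrightarrow> dred (DReturn V) (DReturn V')" |
  dred_let1: "dred M M' \<Longrightarrow> dred (DLet M N) (DLet M' N)" |
  dred_let2: "dred N N' \<Longrightarrow> dred (DLet M N) (DLet M N')" |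
  dred_lam: "dred M M' \<Longrightarrow> dred (DLam M) (DLam M')" |
  dred_app1: "dred M M' \<Longrightarrow> dred (DApp M V) (DApp M' V)" |
  dred_app2: "dred_val V V' \<Longrightarrow> dred (DApp M V) (DApp M V')" |
  dred_with1: "dred M M' \<Longrightarrow> dred (DWith M N) (DWith M' N)" |
  dred_with2: "dred N N' \<Longrightarrow> dred (DWith M N) (DWith M N')" |
  dred_prj: "dred M M' \<Longrightarrow> dred (DPrj i M) (DPrj i M')" |
  dred_shift0: "dred M M' \<Longrightarrow> dred (DShift0 M) (DShift0 M')" |
  dred_reset1: "dred M M' \<Longrightarrow> dred (DReset M N) (DReset M' N)" |
  dred_reset2: "dred N N' \<Longrightarrow> dred (DReset M N) (DReset M N')"

section \<open>The translation\<close>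

text \<open>
  Renamings express freshness.  For reflect, M moves under k and b; inside the innermost lambda,
  x, b, k are the indices 0, 1, 2.  For reify, b is inserted below x in Nu, and w below y and f
  in Nb.
\<close>

primrec trans_val :: "'l mval \<Rightarrow> 'l dval"
  and trans_comp :: "'l mcomp \<Rightarrow> 'l dcomp" where
  "trans_val (MVar n) = DVar n" |
  "trans_val MUnit = DUnit" |
  "trans_val (MPair V W) = DPair (trans_val V) (trans_val W)" |
  "trans_val (MInj l V) = DInj l (trans_val V)" |
  "trans_val (MThunk M) = DThunk (trans_comp M)" |
  "trans_comp (MSplit V M) = DSplit (trans_val V) (trans_comp M)" |
  "trans_comp (MCase V bs) = DCase (trans_val V) (fmmap trans_comp bs)" |
  "trans_comp (MForce V) = DForce (trans_val V)" |
  "trans_comp (MReturn V) = DReturn (trans_val V)" |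
  "trans_comp (MLet M N) = DLet (trans_comp M) (trans_comp N)" |
  "trans_comp (MLam M) = DLam (trans_comp M)" |
  "trans_comp (MApp M V) = DApp (trans_comp M) (trans_val V)" |
  "trans_comp (MWith M N) = DWith (trans_comp M) (trans_comp N)" |
  "trans_comp (MPrj i M) = DPrj i (trans_comp M)" |
  "trans_comp (MReflect M) =
     DShift0 (DLam (DApp (DForce (DVar 0))
       (DPair (DThunk (dren_comp (\<lambda>n. n + 2) (trans_comp M)))
         (DThunk (DLam (DApp (DApp (DForce (DVar 2)) (DVar 0)) (DVar 1)))))))" |
  "trans_comp (MReify Nu Nb M) =
     DApp (DReset (trans_comp M) (DLam (dren_comp Suc (trans_comp Nu))))
       (DThunk (DLam (DSplit (DVar 0)
         (dren_comp (lift_ren (lift_ren Suc)) (trans_comp Nb)))))"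

end

theory Submission
  imports Defs
begin

text \<open>
  The translation commutes with renaming and substitution, so a core step is simulated by the
  same step. For reify-reflect, let K be the thunked continuation captured by the reset and W
  the thunked bind function. Contracting the reset, the binder b and W! applies the bind
  function to the pair of {N*} and {\<lambda>x. K! x W}. The two steps from K! x to the reset around
  the returned x are then taken under the binder x, while the pair is still a single argument:
  after the pair is split there may be any number of copies.
\<close>

section \<open>Renaming and substitution\<close>

lemma lift_ren_simps [simp]:
  "lift_ren r 0 = 0" "lift_ren r (Suc n) = Suc (r n)"
  by (simp_all add: lift_ren_def)

lemma lift_ren_comp: "lift_ren r \<circ> lift_ren q = lift_ren (r \<circ> q)"
  by (rule ext) (simp add: lift_ren_def split: nat.split)

lemma lift_ren_Suc: "lift_ren r \<circ> Suc = Suc \<circ> r"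
  by (rule ext) simp

lemma dlift_simps [simp]:
  "dlift s 0 = DVar 0" "dlift s (Suc n) = dren_val Suc (s n)"
  by (simp_all add: dlift_def)

lemma dlift_Suc: "dlift s \<circ> Suc = dren_val Suc \<circ> s"
  by (rule ext) simp

lemma dlift_DVar: "dlift (DVar \<circ> r) = DVar \<circ> lift_ren r"
  by (rule ext) (simp add: dlift_def lift_ren_def split: nat.split)

lemma dlift_lift_ren: "dlift s \<circ> lift_ren r = dlift (s \<circ> r)"
  by (rule ext) (simp add: dlift_def lift_ren_def split: nat.split)

text \<open>For the branches of a case, the induction hypothesis covers only computations in
  \<open>fmran'\<close>; this form lets the simplifier use it when two traversals are fused.\<close>

lemma fmmap_fmmap_cong:
  assumes "\<And>x. x \<in> fmran' m \<Longrightarrow> f (g x) = h x"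
  shows "fmmap f (fmmap g m) = fmmap h m"
  using assms by (auto simp: fmap.map_comp intro: fmap.map_cong)

lemma dren_dren:
  fixes V :: "'l dval" and M :: "'l dcomp"
  shows "dren_val r (dren_val q V) = dren_val (r \<circ> q) V"
    and "dren_comp r (dren_comp q M) = dren_comp (r \<circ> q) M"
  by (induction V and M arbitrary: r q and r q)
    (simp_all add: lift_ren_comp fmmap_fmmap_cong)

lemma dsub_dren:
  fixes V :: "'l dval" and M :: "'l dcomp"
  shows "dsub_val s (dren_val r V) = dsub_val (s \<circ> r) V"
    and "dsub_comp s (dren_comp r M) = dsub_comp (s \<circ> r) M"
  by (induction V and M arbitrary: s r and s r)
    (simp_all add: dlift_lift_ren fmmap_fmmap_cong)

lemma lift_ren_dlift: "dren_val (lift_ren r) \<circ> dlift s = dlift (dren_val r \<circ> s)"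
  by (rule ext) (simp add: dlift_def dren_dren comp_def split: nat.split)

lemma dren_dsub:
  fixes V :: "'l dval" and M :: "'l dcomp"
  shows "dren_val r (dsub_val s V) = dsub_val (dren_val r \<circ> s) V"
    and "dren_comp r (dsub_comp s M) = dsub_comp (dren_val r \<circ> s) M"
  by (induction V and M arbitrary: r s and r s)
    (simp_all add: lift_ren_dlift fmmap_fmmap_cong)

lemma dsub_DVar_comp:
  fixes V :: "'l dval" and M :: "'l dcomp"
  shows "dsub_val (DVar \<circ> r) V = dren_val r V"
    and "dsub_comp (DVar \<circ> r) M = dren_comp r M"
  by (induction V and M arbitrary: r and r)
    (simp_all add: dlift_DVar cong: fmap.map_cong)

lemma lift_ren_id: "lift_ren (\<lambda>n. n) = (\<lambda>n. n)"
  by (rule ext) (simp add: lift_ren_def split: nat.split)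

lemma dren_id:
  fixes V :: "'l dval" and M :: "'l dcomp"
  shows "dren_val (\<lambda>n. n) V = V" and "dren_comp (\<lambda>n. n) M = M"
  by (induction V and M) (simp_all add: lift_ren_id fmap.map_ident_strong)

text \<open>After \<open>dsub_dren\<close> has fused an instantiation with a weakening, every index
  may be sent to a variable: either the weakening skips the instantiated index, or a variable is put
  there. What remains is a renaming.\<close>

lemma dsub_eq_dren:
  assumes "\<And>n. s n = DVar (r n)"
  shows "dsub_val s V = dren_val r V" and "dsub_comp s M = dren_comp r M"
proof -
  have "s = DVar \<circ> r" using assms by (simp add: fun_eq_iff)
  then show "dsub_val s V = dren_val r V" and "dsub_comp s M = dren_comp r M"
    by (simp_all only: dsub_DVar_comp)
qed

section \<open>The translation commutes with renaming and substitution\<close>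

lemma trans_mren:
  fixes V :: "'l mval" and M :: "'l mcomp"
  shows "trans_val (mren_val r V) = dren_val r (trans_val V)"
    and "trans_comp (mren_comp r M) = dren_comp r (trans_comp M)"
proof (induction V and M arbitrary: r and r)
  case (MCase V bs)
  then show ?case by (simp add: fmap.map_comp cong: fmap.map_cong)
next
  case (MReflect M)
  then show ?case by (simp add: dren_dren comp_def numeral_2_eq_2)
next
  \<comment> \<open>On the bind clause \<open>r\<close> is lifted three times, for w, y and f. Since
    w is inserted outside y and f, this commutes with the doubly lifted \<open>Suc\<close>.\<close>
  case (MReify Nu Nb M)
  then show ?case by (simp add: dren_dren lift_ren_comp) (simp add: comp_def)
qed simp_all

lemma trans_mlift: "(\<lambda>n. trans_val (mlift s n)) = dlift (\<lambda>n. trans_val (s n))"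
  by (rule ext) (simp add: mlift_def dlift_def trans_mren split: nat.split)

lemma trans_msub:
  fixes V :: "'l mval" and M :: "'l mcomp"
  shows "trans_val (msub_val s V) = dsub_val (trans_val \<circ> s) (trans_val V)"
    and "trans_comp (msub_comp s M) = dsub_comp (trans_val \<circ> s) (trans_comp M)"
proof (induction V and M arbitrary: s and s)
  case (MCase V bs)
  then show ?case by (simp add: fmap.map_comp comp_def trans_mlift cong: fmap.map_cong)
next
  case (MReflect M)
  then show ?case
    by (simp add: dren_dsub dsub_dren dren_dren comp_def numeral_2_eq_2)
next
  case (MReify Nu Nb M)
  then show ?case
    by (simp add: dren_dsub dsub_dren trans_mlift lift_ren_dlift dlift_lift_ren dlift_Suc)
qed (simp_all add: trans_mlift comp_def)

lemma trans_minst: "trans_comp (minst M V) = dinst (trans_comp M) (trans_val V)"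
proof -
  have "trans_val \<circ> case_nat V MVar = case_nat (trans_val V) DVar"
    by (rule ext) (simp split: nat.split)
  then show ?thesis by (simp add: minst_def dinst_def trans_msub)
qed

lemma trans_minst2:
  "trans_comp (minst2 M V W) = dinst2 (trans_comp M) (trans_val V) (trans_val W)"
proof -
  have "trans_val \<circ> case_nat W (case_nat V MVar)
      = case_nat (trans_val W) (case_nat (trans_val V) DVar)"
    by (rule ext) (simp split: nat.split)
  then show ?thesis by (simp add: minst2_def dinst2_def trans_msub)
qed

text \<open>Frames go to frames, so the image of a hoisting context is again one, and the translated
  reset can capture it.\<close>

primrec trans_frame :: "'l mframe \<Rightarrow> 'l dframe" where
  "trans_frame (MFLet N) = DFLet (trans_comp N)" |
  "trans_frame (MFApp V) = DFApp (trans_val V)" |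
  "trans_frame (MFPrj i) = DFPrj i"

primrec trans_hoist :: "'l mhoist \<Rightarrow> 'l dhoist" where
  "trans_hoist MHHole = DHHole" |
  "trans_hoist (MHFrame H B) = DHFrame (trans_hoist H) (trans_frame B)"

lemma trans_mplug_frame:
  "trans_comp (mplug_frame B M) = dplug_frame (trans_frame B) (trans_comp M)"
  by (cases B) simp_all

lemma trans_mplug_hoist:
  "trans_comp (mplug_hoist H M) = dplug_hoist (trans_hoist H) (trans_comp M)"
  by (induction H arbitrary: M) (simp_all add: trans_mplug_frame)

lemma trans_mren_frame: "trans_frame (mren_frame r B) = dren_frame r (trans_frame B)"
  by (cases B) (simp_all add: trans_mren)

lemma trans_mren_hoist: "trans_hoist (mren_hoist r H) = dren_hoist r (trans_hoist H)"
  by (induction H) (simp_all add: trans_mren_frame)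

section \<open>Simulation\<close>

lemma tranclp_map:
  assumes "r\<^sup>+\<^sup>+ x y" and "\<And>x y. r x y \<Longrightarrow> q (f x) (f y)"
  shows "q\<^sup>+\<^sup>+ (f x) (f y)"
  using assms(1) by induction (auto intro: assms(2) tranclp.intros)

lemma dred_trancl_frame:
  "dred\<^sup>+\<^sup>+ M N \<Longrightarrow> dred\<^sup>+\<^sup>+ (dplug_frame B M) (dplug_frame B N)"
  by (cases B) (auto elim!: tranclp_map intro: dred_let1 dred_app1 dred_prj)

text \<open>A reify becomes a reset applied to the thunked bind function, so its hole is reached
  through two congruences.\<close>

lemma trans_mreify_red:
  "dred\<^sup>+\<^sup>+ (trans_comp M) (trans_comp N) \<Longrightarrow>
     dred\<^sup>+\<^sup>+ (trans_comp (MReify Nu Nb M)) (trans_comp (MReify Nu Nb N))"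
  by (auto elim!: tranclp_map intro: dred_app1 dred_reset1)

text \<open>Evaluation contexts grow at the hole, so the induction hypothesis is applied to the
  computations already wrapped in the innermost layer.\<close>

lemma trans_ectx_red:
  "dred\<^sup>+\<^sup>+ (trans_comp M) (trans_comp N) \<Longrightarrow>
     dred\<^sup>+\<^sup>+ (trans_comp (mplug_ectx K M)) (trans_comp (mplug_ectx K N))"
proof (induction K arbitrary: M N)
  case (MEFrame K B)
  then show ?case by (simp add: trans_mplug_frame dred_trancl_frame)
next
  case (MEReify K Nu Nb)
  then show ?case by (simp only: mplug_ectx.simps trans_mreify_red)
qed simp

lemma trans_reify_return:
  "dred\<^sup>+\<^sup>+ (trans_comp (MReify Nu Nb (MReturn V))) (trans_comp (minst Nu V))"
proof -
  let ?W = "DThunk (DLam (DSplit (DVar 0)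
              (dren_comp (lift_ren (lift_ren Suc)) (trans_comp Nb))))"
  let ?L = "DLam (dren_comp Suc (trans_comp Nu))"
  have "dred (DApp (DReset (DReturn (trans_val V)) ?L) ?W)
          (DApp (dinst ?L (trans_val V)) ?W)"
    by (intro dred_app1 dred_beta dbeta_reset_return)
  moreover have "dinst ?L (trans_val V)
      = DLam (dren_comp Suc (dinst (trans_comp Nu) (trans_val V)))"
    by (simp add: dinst_def dsub_dren dren_dsub dlift_Suc)
  \<comment> \<open>The second step feeds the bind function to b, which does not occur in the return
    clause, and so discards it.\<close>
  moreover have "dred (DApp (DLam (dren_comp Suc M)) ?W) M" for M
  proof -
    have "dinst (dren_comp Suc M) ?W = dsub_comp (DVar \<circ> (\<lambda>n. n)) M"
      by (simp add: dinst_def dsub_dren comp_def)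
    then have "dinst (dren_comp Suc M) ?W = M"
      by (simp only: dsub_DVar_comp dren_id)
    then show ?thesis by (metis dbeta_app dred_beta)
  qed
  ultimately show ?thesis
    unfolding trans_minst trans_comp.simps by (metis tranclp.simps)
qed

lemma trans_reify_reflect:
  fixes H :: "'l mhoist"
  shows "dred\<^sup>+\<^sup>+ (trans_comp (MReify Nu Nb (mplug_hoist H (MReflect N))))
     (trans_comp (minst2 Nb (MThunk N)
         (MThunk (MLam
           (MReify (mren_comp (lift_ren Suc) Nu) (mren_comp (lift_ren (lift_ren Suc)) Nb)
             (mplug_hoist (mren_hoist Suc H) (MReturn (MVar 0))))))))"
proof -
  \<comment> \<open>\<open>P\<close> is the bind function and \<open>L\<close> the return clause of
    the reset. \<open>R\<close> is the body of the captured continuation \<open>K\<close>, and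
    \<open>W'\<close> is the thunked bind function moved under the binder x.\<close>
  define P where "P = DLam (DSplit (DVar 0)
              (dren_comp (lift_ren (lift_ren Suc)) (trans_comp Nb)))"
  define L where "L = DLam (dren_comp Suc (trans_comp Nu))"
  define R where "R = DReset (dplug_hoist (dren_hoist Suc (trans_hoist H)) (DReturn (DVar 0)))
           (dren_comp (lift_ren Suc) L)"
  define K where "K = DThunk (DLam R)"
  define W where "W = DThunk P"
  define n where "n = trans_comp N"
  define W' where "W' = dren_val Suc W"
  let ?shift = "DLam (DApp (DForce (DVar 0))
       (DPair (DThunk (dren_comp (\<lambda>n. n + 2) n))
         (DThunk (DLam (DApp (DApp (DForce (DVar 2)) (DVar 0)) (DVar 1))))))"
  \<comment> \<open>The reflected term after \<open>K\<close> has replaced k: b is still bound, so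
    \<open>n\<close> is weakened once, and \<open>K\<close> twice, for b and x.\<close>
  let ?body = "DApp (DForce (DVar 0))
       (DPair (DThunk (dren_comp Suc n))
         (DThunk (DLam (DApp (DApp (DForce (dren_val Suc (dren_val Suc K))) (DVar 0)) (DVar 1)))))"
  let ?pair = "\<lambda>Q. DPair (DThunk n) (DThunk (DLam (DApp Q W')))"
  have shift: "dred (DApp (DReset (dplug_hoist (trans_hoist H) (DShift0 ?shift)) L) W)
     (DApp (DLam ?body) W)"
  proof -
    \<comment> \<open>Under b the variable k has index 1, which the shift by 2 skips; removing k
      leaves a shift by 1.\<close>
    have "dsub_comp (dlift (case_nat V DVar)) (dren_comp (\<lambda>n. n + 2) n) = dren_comp Suc n" for V
      by (simp add: dsub_dren) (rule dsub_eq_dren, simp)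
    then have "dinst ?shift K = DLam ?body"
      by (simp add: dinst_def numeral_2_eq_2)
    then show ?thesis
      unfolding K_def R_def by (metis dred_app1 dred_beta dbeta_reset_shift0)
  qed
  have app: "dred (DApp (DLam ?body) W)
     (DApp (DForce W) (?pair (DApp (DForce (dren_val Suc K)) (DVar 0))))"
  proof -
    have "dsub_comp (case_nat W DVar) (dren_comp Suc n) = dren_comp (\<lambda>n. n) n"
      by (simp add: dsub_dren) (rule dsub_eq_dren, simp)
    moreover have "dsub_val (dlift (case_nat W DVar)) (dren_val Suc (dren_val Suc K)) = dren_val Suc K"
      by (simp add: dren_dren dsub_dren) (rule dsub_eq_dren, simp)
    ultimately have "dinst ?body W
        = DApp (DForce W) (?pair (DApp (DForce (dren_val Suc K)) (DVar 0)))"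
      by (simp add: dinst_def W'_def dren_id)
    then show ?thesis by (metis dbeta_app dred_beta)
  qed
  have force: "dred (DApp (DForce W) V) (DApp P V)" for V
    unfolding W_def by (intro dred_app1 dred_beta dbeta_force)
  have force_K: "dred (DApp P (?pair (DApp (DForce (dren_val Suc K)) (DVar 0))))
     (DApp P (?pair (DApp (DLam (dren_comp (lift_ren Suc) R)) (DVar 0))))"
    unfolding K_def dren_val.simps dren_comp.simps
    by (intro dred_app2 dred_pair2 dred_thunk dred_lam dred_app1 dred_beta dbeta_force)
  have app_K: "dred (DApp P (?pair (DApp (DLam (dren_comp (lift_ren Suc) R)) (DVar 0))))
     (DApp P (?pair R))"
  proof -
    \<comment> \<open>Index 0 of \<open>R\<close> is the binder of \<open>K\<close>, and x takes its
      place. All other indices were raised past x and drop back, so \<open>R\<close> itself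
      returns.\<close>
    have "dsub_comp (case_nat (DVar 0) DVar) (dren_comp (lift_ren Suc) R) = dren_comp (\<lambda>n. n) R"
      by (simp only: dsub_dren) (rule dsub_eq_dren, simp add: lift_ren_def split: nat.split)
    then have "dbeta (DApp (DLam (dren_comp (lift_ren Suc) R)) (DVar 0)) R"
      using dbeta_app[of "dren_comp (lift_ren Suc) R" "DVar 0"] by (simp add: dinst_def dren_id)
    then show ?thesis
      by (intro dred_app2 dred_pair2 dred_thunk dred_lam dred_app1 dred_beta)
  qed
  have app_P: "dred (DApp P V) (DSplit V (trans_comp Nb))" for V
  proof -
    \<comment> \<open>The translated bind clause was weakened past w, so instantiating w only
      cancels that weakening; \<open>V\<close> lands in the scrutinee alone.\<close>
    have "dlift (dlift (case_nat V DVar)) \<circ> lift_ren (lift_ren Suc) = DVar \<circ> (\<lambda>n. n)"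
      by (rule ext) (simp add: dlift_def lift_ren_def split: nat.split)
    then have "dinst (DSplit (DVar 0) (dren_comp (lift_ren (lift_ren Suc)) (trans_comp Nb))) V
        = DSplit V (trans_comp Nb)"
      by (simp only: dinst_def dsub_comp.simps dsub_val.simps dsub_dren dsub_DVar_comp dren_id nat.case)
    then show ?thesis unfolding P_def by (metis dbeta_app dred_beta)
  qed
  have split_pair: "dred (DSplit (?pair R) (trans_comp Nb))
     (dinst2 (trans_comp Nb) (DThunk n) (DThunk (DLam (DApp R W'))))"
    by (intro dred_beta dbeta_split)
  \<comment> \<open>The inner reify of the contractum translates to a reset applied to its bind
    function. These are \<open>R\<close> and \<open>W'\<close>, because the weakening under z
    commutes with the insertions of b and w.\<close>
  have target: "trans_comp (minst2 Nb (MThunk N)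
         (MThunk (MLam
           (MReify (mren_comp (lift_ren Suc) Nu) (mren_comp (lift_ren (lift_ren Suc)) Nb)
             (mplug_hoist (mren_hoist Suc H) (MReturn (MVar 0)))))))
     = dinst2 (trans_comp Nb) (DThunk n) (DThunk (DLam (DApp R W')))"
    by (simp add: trans_minst2 trans_mplug_hoist trans_mren_hoist trans_mren dren_dren
        lift_ren_comp lift_ren_Suc n_def R_def L_def W'_def W_def P_def)
  have source: "trans_comp (MReify Nu Nb (mplug_hoist H (MReflect N)))
     = DApp (DReset (dplug_hoist (trans_hoist H) (DShift0 ?shift)) L) W"
    by (simp add: trans_mplug_hoist n_def L_def W_def P_def)
  \<comment> \<open>Seven steps in all; the chain is peeled from its last step back to the first,
    \<open>shift\<close>.\<close>
  show ?thesis
    unfolding source target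
    by (rule tranclp.trancl_into_trancl[where r = dred, OF _ split_pair],
        rule tranclp.trancl_into_trancl[where r = dred, OF _ app_P],
        rule tranclp.trancl_into_trancl[where r = dred, OF _ app_K],
        rule tranclp.trancl_into_trancl[where r = dred, OF _ force_K],
        rule tranclp.trancl_into_trancl[where r = dred, OF _ force],
        rule tranclp.trancl_into_trancl[where r = dred, OF _ app],
        rule tranclp.r_into_trancl[where r = dred, OF shift])
qed

lemma trans_beta:
  "mbeta M N \<Longrightarrow> dred\<^sup>+\<^sup>+ (trans_comp M) (trans_comp N)"
proof (induction rule: mbeta.induct)
  case (mbeta_split V W M)
  then show ?case by (simp add: trans_minst2 tranclp.r_into_trancl dred_beta dbeta_split)
next
  case (mbeta_case bs l M V)
  then show ?case by (simp add: trans_minst tranclp.r_into_trancl dred_beta dbeta_case)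
next
  case (mbeta_reify_return Nu Nb V)
  show ?case by (rule trans_reify_return)
next
  case (mbeta_reify_reflect Nu Nb H N)
  show ?case by (rule trans_reify_reflect)
qed (simp_all add: trans_minst tranclp.r_into_trancl dred_beta dbeta.intros)

theorem theorem6p5:
  fixes M N :: "'l mcomp"
  assumes "mstep M N"
  shows "dred\<^sup>+\<^sup>+ (trans_comp M) (trans_comp N)"
  using assms by cases (auto intro: trans_ectx_red trans_beta)

end
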